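(* Let $p\in\mathbb{N}$ be fixed. For each $f\in C_{x^2}[0,\infty)$ and each $\alpha>0$, $$\lim_{n\to\infty}\ \sup_{x\in[0,\infty)}\frac{|\mathcal{L}_{n,p}(f,x)-f(x)|}{(1+x^2)^{1+\alpha}}=0.$$
   Context: $\mathbb{N}$ denotes the positive integers. For $n,p\in\mathbb{N}$ and suitable $f:[0,\infty)\to\mathbb{R}$, the Baskakov-Schurer-Szász operator is $$\mathcal{L}_{n,p}(f,x)=(n+p)\sum_{k=0}^{\infty}b^k_{n,p}(x)\int_0^\infty f(t)\,s^k_{n,p}(t)\,dt,\qquad x\in[0,\infty),$$ where $b^k_{n,p}(x)=\binom{n+p+k-1}{k}\frac{x^k}{(1+x)^{n+p+k}}$ and $s^k_{n,p}(t)=e^{-(n+p)t}\frac{((n+p)t)^k}{k!}$. $C_{x^2}[0,\infty)$ is the space of continuous $f:[0,\infty)\to\mathbb{R}$ for which there is a constant $M_f$ with $|f(x)|\le M_f(1+x^2)$ for all $x\ge0$. *)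

theory Defs
  imports "HOL-Analysis.Analysis"
begin

(* The truncated subtraction in the binomial coefficient is harmless as long as n + p \<ge> 1. *)
definition baskakov_basis :: "nat \<Rightarrow> nat \<Rightarrow> nat \<Rightarrow> real \<Rightarrow> real" where
  "baskakov_basis n p k x =
     real ((n + p + k - 1) choose k) * (x ^ k / (1 + x) ^ (n + p + k))"

definition szasz_basis :: "nat \<Rightarrow> nat \<Rightarrow> nat \<Rightarrow> real \<Rightarrow> real" where
  "szasz_basis n p k t =
     exp (- (real (n + p) * t)) * ((real (n + p) * t) ^ k / fact k)"

definition BSS_operator :: "nat \<Rightarrow> nat \<Rightarrow> (real \<Rightarrow> real) \<Rightarrow> real \<Rightarrow> real" where
  "BSS_operator n p f x =
     real (n + p) * (\<Sum>k. baskakov_basis n p k x *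
       (LINT t:{0..}|lborel. f t * szasz_basis n p k t))"

(* Functions on [0, \<infinity>) are represented by total functions on the reals;
   their values at negative arguments are irrelevant. *)
definition C_x2 :: "(real \<Rightarrow> real) set" where
  "C_x2 = {f. continuous_on {0..} f \<and> (\<exists>M. \<forall>x\<ge>0. \<bar>f x\<bar> \<le> M * (1 + x\<^sup>2))}"

end

theory Submission
  imports Defs "HOL-Probability.Distributions" "HOL-Real_Asymp.Real_Asymp"
begin

text \<open>
  Write \<open>m = n + p\<close>. The operator averages \<open>f\<close> against a probability measure on
  \<open>[0, \<infinity>)\<close>: the index \<open>k\<close> is drawn from the negative binomial distribution
  \<open>baskakov_basis n p k x\<close>, and then \<open>t\<close> from the Erlang distribution with density
  \<open>m * szasz_basis n p k t\<close>. The second moment about \<open>x\<close> of this measure is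
  \<open>(x\<^sup>2 + 2 * x) / m + 2 / m\<^sup>2\<close>, which is at most \<open>4 * (1 + x\<^sup>2) / m\<close>. Therefore a
  pointwise bound \<open>\<bar>f t - f x\<bar> \<le> A + B * (t - x)\<^sup>2\<close> for all \<open>t \<ge> 0\<close> integrates to an
  error of at most \<open>A + B * (4 * (1 + x\<^sup>2) / m)\<close> (lemma \<open>BSS_error_bound\<close>).

  Two such pointwise bounds settle the theorem. For every \<open>x\<close>, the growth condition on \<open>f\<close>
  supplies one in which \<open>A\<close> is \<open>O(1 + x\<^sup>2)\<close> and \<open>B\<close> is constant, so the error is \<open>O(1 + x\<^sup>2)\<close>
  uniformly in \<open>n\<close>, and the extra factor \<open>(1 + x\<^sup>2) powr \<alpha>\<close> in the weight makes the
  quotient small for all large \<open>x\<close>, say \<open>x \<ge> R\<close>. On \<open>[0, R]\<close>, uniform continuity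
  supplies one in which \<open>A\<close> is arbitrarily small and \<open>B\<close> does not depend on \<open>x\<close>
  (lemma \<open>quadratic_modulus_on_compact\<close>); this is Korovkin's argument, and the
  \<open>B\<close> term vanishes as \<open>m\<close> grows.
\<close>

section \<open>Moments of the Szasz weights\<close>

text \<open>Up to the normalising factor \<open>n + p\<close>, the Szasz weight is the Erlang density, whose
  moments are known.\<close>

lemma szasz_moment:
  fixes n p k i :: nat
  assumes "n + p > 0"
  shows "set_integrable lborel {0..} (\<lambda>t. t ^ i * szasz_basis n p k t)"
    and "real (n + p) * (LINT t:{0..}|lborel. t ^ i * szasz_basis n p k t)
           = fact (k + i) / (fact k * real (n + p) ^ i)"
proof -
  define m where "m = real (n + p)"
  have m: "m > 0"
    using assms unfolding m_def of_nat_0_less_iff .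
  have eq: "indicator {0..} t *\<^sub>R (t ^ i * szasz_basis n p k t)
      = inverse m * (erlang_density k m t * t ^ i)" for t
    unfolding erlang_density_def szasz_basis_def m_def[symmetric]
    using m by (simp add: power_mult_distrib)
  have "has_bochner_integral lborel (\<lambda>t. erlang_density k m t * t ^ i)
      (fact (k + i) / (fact k * m ^ i))"
  proof (rule has_bochner_integral_nn_integral)
    show "AE t in lborel. 0 \<le> erlang_density k m t * t ^ i"
      using m by (intro AE_I2) (auto simp: erlang_density_def)
  qed (use m nn_integral_erlang_ith_moment[OF m, of k i] in auto)
  then have hbi: "has_bochner_integral lborel
      (\<lambda>t. indicator {0..} t *\<^sub>R (t ^ i * szasz_basis n p k t))
      (inverse m * (fact (k + i) / (fact k * m ^ i)))"
    unfolding eq by (rule has_bochner_integral_mult_right)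
  then show "set_integrable lborel {0..} (\<lambda>t. t ^ i * szasz_basis n p k t)"
    unfolding set_integrable_def by (rule integrable.intros)
  from hbi have "(LINT t:{0..}|lborel. t ^ i * szasz_basis n p k t)
      = inverse m * (fact (k + i) / (fact k * m ^ i))"
    unfolding set_lebesgue_integral_def by (rule has_bochner_integral_integral_eq)
  then show "real (n + p) * (LINT t:{0..}|lborel. t ^ i * szasz_basis n p k t)
      = fact (k + i) / (fact k * real (n + p) ^ i)"
    unfolding m_def[symmetric] using m by simp
qed

lemma szasz_basis_nonneg: "t \<ge> 0 \<Longrightarrow> szasz_basis n p k t \<ge> 0"
  by (simp add: szasz_basis_def)

lemma szasz_quadratic_integral:
  fixes n p k :: nat and A B x :: real
  assumes "n + p > 0"
  shows "set_integrable lborel {0..} (\<lambda>t. (A + B * (t - x)\<^sup>2) * szasz_basis n p k t)"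
    and "real (n + p) * (LINT t:{0..}|lborel. (A + B * (t - x)\<^sup>2) * szasz_basis n p k t)
           = A + B * ((real k + 1) * (real k + 2) / (real (n + p))\<^sup>2
                      - 2 * x * (real k + 1) / real (n + p) + x\<^sup>2)"
proof -
  define s where "s = szasz_basis n p k"
  define I where "I i = (LINT t:{0..}|lborel. t ^ i * s t)" for i :: nat
  have int: "set_integrable lborel {0..} (\<lambda>t. t ^ i * s t)" for i
    using szasz_moment(1)[OF assms] by (simp add: s_def)
  have eq: "(A + B * (t - x)\<^sup>2) * szasz_basis n p k t
      = (A + B * x\<^sup>2) * (t ^ 0 * s t) + ((- 2 * B * x) * (t ^ 1 * s t) + B * (t ^ 2 * s t))" for t
    by (simp add: s_def power2_eq_square algebra_simps)
  note ints = set_integral_add set_integrable_mult_right int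
  show "set_integrable lborel {0..} (\<lambda>t. (A + B * (t - x)\<^sup>2) * szasz_basis n p k t)"
    unfolding eq by (intro ints)
  have split: "(LINT t:{0..}|lborel. (A + B * (t - x)\<^sup>2) * szasz_basis n p k t)
      = (A + B * x\<^sup>2) * I 0 + ((- 2 * B * x) * I 1 + B * I 2)"
    unfolding eq I_def by (subst set_integral_add(2), (intro ints)+)+
      (simp only: set_integral_mult_right)
  have I0: "real (n + p) * I 0 = 1"
    using szasz_moment(2)[OF assms, of 0 k] by (simp add: I_def s_def)
  have I1: "real (n + p) * I 1 = (real k + 1) / real (n + p)"
    using szasz_moment(2)[OF assms, of 1 k] by (simp add: I_def s_def add.commute del: of_nat_add)
  have I2: "real (n + p) * I 2 = (real k + 1) * (real k + 2) / (real (n + p))\<^sup>2"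
  proof -
    have "fact (k + 2) = fact k * ((real k + 1) * (real k + 2))"
      by (simp add: algebra_simps)
    then show ?thesis
      using szasz_moment(2)[OF assms, of 2 k] by (simp add: I_def s_def del: of_nat_add)
  qed
  have "real (n + p) * (LINT t:{0..}|lborel. (A + B * (t - x)\<^sup>2) * szasz_basis n p k t)
      = (A + B * x\<^sup>2) * (real (n + p) * I 0)
          + ((- 2 * B * x) * (real (n + p) * I 1) + B * (real (n + p) * I 2))"
    unfolding split by (simp add: algebra_simps)
  also have "\<dots> = A + B * (real (n + p) * I 2 - 2 * x * (real (n + p) * I 1) + x\<^sup>2)"
    unfolding I0 by (simp add: algebra_simps)
  finally show "real (n + p) * (LINT t:{0..}|lborel. (A + B * (t - x)\<^sup>2) * szasz_basis n p k t)
           = A + B * ((real k + 1) * (real k + 2) / (real (n + p))\<^sup>2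
                      - 2 * x * (real k + 1) / real (n + p) + x\<^sup>2)"
    unfolding I1 I2 by simp
qed

text \<open>Integrating the pointwise estimate against the \<open>k\<close>-th Szasz weight. Integrability of
  \<open>g\<close> against that weight is part of what the estimate provides.\<close>

lemma szasz_integral_error:
  fixes g :: "real \<Rightarrow> real" and n p k :: nat and A B c x :: real
  assumes np: "n + p > 0" and cont: "continuous_on {0..} g"
    and bound: "\<And>t. t \<ge> 0 \<Longrightarrow> \<bar>g t - c\<bar> \<le> A + B * (t - x)\<^sup>2"
  shows "\<bar>real (n + p) * (LINT t:{0..}|lborel. g t * szasz_basis n p k t) - c\<bar>
           \<le> A + B * ((real k + 1) * (real k + 2) / (real (n + p))\<^sup>2
                      - 2 * x * (real k + 1) / real (n + p) + x\<^sup>2)"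
proof -
  let ?s = "szasz_basis n p k"
  let ?q = "\<lambda>t. (A + B * (t - x)\<^sup>2) * ?s t"
  note quad = szasz_quadratic_integral[OF np, where k = k]
  have int_q: "set_integrable lborel {0..} ?q"
    by (rule quad)
  have le: "\<bar>(g t - c) * ?s t\<bar> \<le> ?q t" if "t \<ge> 0" for t
    using bound[OF that] szasz_basis_nonneg[OF that, of n p k]
    by (simp add: abs_mult mult_right_mono)
  have "continuous_on {0..} (\<lambda>t. (g t - c) * ?s t)"
    unfolding szasz_basis_def by (intro continuous_intros cont) auto
  then have "set_borel_measurable lborel {0..} (\<lambda>t. (g t - c) * ?s t)"
    unfolding set_borel_measurable_def
    using borel_measurable_continuous_on_indicator[of "{0::real..}" "\<lambda>t. (g t - c) * ?s t"]
    by simp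
  then have int_d: "set_integrable lborel {0..} (\<lambda>t. (g t - c) * ?s t)"
    by (rule set_integrable_bound[OF int_q]) (use le in force)
  have int_c: "set_integrable lborel {0..} (\<lambda>t. c * ?s t)"
    and c: "real (n + p) * (LINT t:{0..}|lborel. c * ?s t) = c"
    using quad[of c 0 0] by simp_all
  have "(\<lambda>t. g t * ?s t) = (\<lambda>t. (g t - c) * ?s t + c * ?s t)"
    by (simp add: algebra_simps)
  then have "real (n + p) * (LINT t:{0..}|lborel. g t * ?s t) - c
      = real (n + p) * (LINT t:{0..}|lborel. (g t - c) * ?s t)"
    using set_integral_add(2)[OF int_d int_c] c by (simp add: algebra_simps)
  also have "\<bar>\<dots>\<bar> \<le> real (n + p) * (LINT t:{0..}|lborel. \<bar>(g t - c) * ?s t\<bar>)"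
    using set_integral_norm_bound[OF int_d] by (simp add: abs_mult mult_left_mono)
  also have "\<dots> \<le> real (n + p) * (LINT t:{0..}|lborel. ?q t)"
    using set_integral_mono[OF set_integrable_abs[OF int_d] int_q] le
    by (intro mult_left_mono) auto
  finally show ?thesis
    using quad(2)[of A B x] by simp
qed

section \<open>Moments of the Baskakov weights\<close>

lemma baskakov_basis_nonneg: "x \<ge> 0 \<Longrightarrow> baskakov_basis n p k x \<ge> 0"
  by (simp add: baskakov_basis_def)

text \<open>With \<open>z = x / (1 + x)\<close> this is the binomial series for \<open>(1 - z) powr (- (n + p))\<close>.\<close>

lemma baskakov_sums_1:
  fixes n p :: nat and x :: real
  assumes "n + p > 0" "x \<ge> 0"
  shows "(\<lambda>k. baskakov_basis n p k x) sums 1"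
proof -
  define m z where "m = n + p" and "z = x / (1 + x)"
  have m: "m > 0" and z: "\<bar>- z\<bar> < 1" and z': "1 + - z = inverse (1 + x)"
    using assms by (auto simp: m_def z_def field_simps)
  have coeff: "((- real m) gchoose k) * (- z) ^ k = real ((m + k - 1) choose k) * z ^ k" for k
  proof -
    have "(real m + real k - 1 gchoose k) = real ((m + k - 1) choose k)"
      using m by (subst binomial_gbinomial) (simp add: of_nat_diff)
    then show ?thesis
      by (simp add: gbinomial_minus power_minus[of z])
  qed
  have "(\<lambda>k. real ((m + k - 1) choose k) * z ^ k) sums (inverse (1 + x) powr (- real m))"
    using gen_binomial_real[OF z, of "- real m"] unfolding coeff z' .
  also have "inverse (1 + x) powr (- real m) = (1 + x) ^ m"
    using assms by (simp add: powr_minus powr_realpow power_inverse)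
  finally have "(\<lambda>k. inverse ((1 + x) ^ m) * (real ((m + k - 1) choose k) * z ^ k))
      sums (inverse ((1 + x) ^ m) * (1 + x) ^ m)"
    by (rule sums_mult)
  moreover have "inverse ((1 + x) ^ m) * (real ((m + k - 1) choose k) * z ^ k)
      = baskakov_basis n p k x" for k
    by (simp add: baskakov_basis_def m_def z_def power_divide power_add field_simps)
  ultimately show ?thesis
    using assms by simp
qed

text \<open>Size biasing a negative binomial distribution raises its order by one; this reduces the
  factorial moments to the total mass.\<close>

lemma baskakov_size_bias:
  fixes n p k :: nat and x :: real
  assumes "n + p > 0"
  shows "real (Suc k) * baskakov_basis n p (Suc k) x
           = real (n + p) * x * baskakov_basis (Suc n) p k x"
proof -
  obtain r where r: "n + p = Suc r"
    using assms gr0_implies_Suc by blast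
  have "Suc k * (Suc (r + k) choose Suc k) = Suc (r + k) * (r + k choose k)"
    by (rule Suc_times_binomial)
  moreover have "Suc r * (Suc (r + k) choose k) = Suc (r + k) * (r + k choose k)"
    using binomial_absorb_comp[of "Suc (r + k)" k] by simp
  ultimately have "Suc k * (Suc (r + k) choose Suc k) = Suc r * (Suc (r + k) choose k)"
    by simp
  then have "real (Suc k) * real (Suc (r + k) choose Suc k)
      = real (Suc r) * real (Suc (r + k) choose k)"
    unfolding of_nat_mult[symmetric] by (rule arg_cong)
  moreover have "n + p + Suc k - 1 = Suc (r + k)" "Suc n + p + k - 1 = Suc (r + k)"
    "n + p + Suc k = Suc (Suc (r + k))" "Suc n + p + k = Suc (Suc (r + k))"
    using r by simp_all
  ultimately show ?thesis
    unfolding baskakov_basis_def r by (simp del: of_nat_Suc)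
qed

lemma baskakov_first_moment:
  fixes n p :: nat and x :: real
  assumes "n + p > 0" "x \<ge> 0"
  shows "(\<lambda>k. real k * baskakov_basis n p k x) sums (real (n + p) * x)"
proof -
  have "(\<lambda>k. real (Suc k) * baskakov_basis n p (Suc k) x) sums (real (n + p) * x * 1)"
    unfolding baskakov_size_bias[OF assms(1)]
    by (intro sums_mult baskakov_sums_1) (use assms in auto)
  then show ?thesis
    by (subst (asm) sums_Suc_iff) simp
qed

lemma baskakov_second_factorial_moment:
  fixes n p :: nat and x :: real
  assumes "n + p > 0" "x \<ge> 0"
  shows "(\<lambda>k. real k * (real k - 1) * baskakov_basis n p k x)
           sums (real (n + p) * (real (n + p) + 1) * x\<^sup>2)"
proof -
  have eq: "real (Suc k) * (real (Suc k) - 1) * baskakov_basis n p (Suc k) x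
      = real (n + p) * x * (real k * baskakov_basis (Suc n) p k x)" for k
  proof -
    have "real (Suc k) * (real (Suc k) - 1) * baskakov_basis n p (Suc k) x
        = real k * (real (Suc k) * baskakov_basis n p (Suc k) x)"
      by simp
    then show ?thesis
      unfolding baskakov_size_bias[OF assms(1)] by simp
  qed
  have "(\<lambda>k. real (Suc k) * (real (Suc k) - 1) * baskakov_basis n p (Suc k) x)
      sums (real (n + p) * x * (real (Suc n + p) * x))"
    unfolding eq by (intro sums_mult baskakov_first_moment) (use assms in auto)
  then show ?thesis
    by (subst (asm) sums_Suc_iff) (simp add: power2_eq_square algebra_simps)
qed

section \<open>From pointwise bounds to bounds on the operator\<close>

lemma BSS_quadratic_sums:
  fixes n p :: nat and A B x :: real
  assumes np: "n + p > 0" and x: "x \<ge> 0"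
  shows "(\<lambda>k. baskakov_basis n p k x *
            (A + B * ((real k + 1) * (real k + 2) / (real (n + p))\<^sup>2
                      - 2 * x * (real k + 1) / real (n + p) + x\<^sup>2)))
         sums (A + B * ((x\<^sup>2 + 2 * x) / real (n + p) + 2 / (real (n + p))\<^sup>2))"
proof -
  define m where "m = real (n + p)"
  define b where "b k = baskakov_basis n p k x" for k
  have m: "m > 0"
    using np unfolding m_def of_nat_0_less_iff .
  \<comment> \<open>expand the quadratic in the basis \<open>1\<close>, \<open>k\<close>, \<open>k * (k - 1)\<close>\<close>
  let ?c0 = "A + B * (2 / m\<^sup>2 - 2 * x / m + x\<^sup>2)"
  let ?c1 = "B * (4 / m\<^sup>2 - 2 * x / m)"
  let ?c2 = "B / m\<^sup>2"
  have "(\<lambda>k. ?c0 * b k + ?c1 * (real k * b k) + ?c2 * (real k * (real k - 1) * b k))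
      sums (?c0 * 1 + ?c1 * (m * x) + ?c2 * (m * (m + 1) * x\<^sup>2))"
    unfolding b_def m_def
    by (intro sums_add sums_mult baskakov_sums_1 baskakov_first_moment
        baskakov_second_factorial_moment np x)
  moreover have "?c0 * b k + ?c1 * (real k * b k) + ?c2 * (real k * (real k - 1) * b k)
      = b k * (A + B * ((real k + 1) * (real k + 2) / m\<^sup>2 - 2 * x * (real k + 1) / m + x\<^sup>2))" for k
    using m by (simp add: field_simps power2_eq_square)
  moreover have "?c0 * 1 + ?c1 * (m * x) + ?c2 * (m * (m + 1) * x\<^sup>2)
      = A + B * ((x\<^sup>2 + 2 * x) / m + 2 / m\<^sup>2)"
    using m by (simp add: field_simps power2_eq_square)
  ultimately show ?thesis
    by (simp only: b_def m_def)
qed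

text \<open>Since the Baskakov weights sum to \<open>1\<close>, the error at \<open>x\<close> is the weighted sum of the
  deviations \<open>m * J k - g x\<close> of the Szasz means \<open>m * J k\<close>. The second moment series dominates
  it termwise, which also makes the series that defines the operator converge.\<close>

lemma BSS_error_bound:
  fixes g :: "real \<Rightarrow> real" and n p :: nat and A B x :: real
  assumes np: "n + p > 0" and x: "x \<ge> 0" and cont: "continuous_on {0..} g" and B: "B \<ge> 0"
    and bound: "\<And>t. t \<ge> 0 \<Longrightarrow> \<bar>g t - g x\<bar> \<le> A + B * (t - x)\<^sup>2"
  shows "\<bar>BSS_operator n p g x - g x\<bar> \<le> A + B * (4 * (1 + x\<^sup>2) / real (n + p))"
proof -
  define m where "m = real (n + p)"
  have m: "m \<ge> 1"
    using np unfolding m_def by linarith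
  define b where "b k = baskakov_basis n p k x" for k
  define J where "J k = (LINT t:{0..}|lborel. g t * szasz_basis n p k t)" for k
  define q where "q k = A + B * ((real k + 1) * (real k + 2) / m\<^sup>2
                                 - 2 * x * (real k + 1) / m + x\<^sup>2)" for k
  have b_sums: "b sums 1"
    using baskakov_sums_1[OF np x] by (simp add: b_def[abs_def])
  have q_sums: "(\<lambda>k. b k * q k) sums (A + B * ((x\<^sup>2 + 2 * x) / m + 2 / m\<^sup>2))"
    using BSS_quadratic_sums[OF np x] by (simp add: b_def q_def m_def)
  have le: "\<bar>b k * (m * J k - g x)\<bar> \<le> b k * q k" for k
    using szasz_integral_error[OF np cont bound, of k] baskakov_basis_nonneg[OF x, of n p k]
    by (simp add: abs_mult b_def m_def J_def q_def mult_left_mono)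
  have summable: "summable (\<lambda>k. \<bar>b k * (m * J k - g x)\<bar>)"
    by (rule summable_comparison_test_ev[OF _ sums_summable[OF q_sums]])
      (use le in \<open>simp add: eventually_sequentially\<close>)
  define S where "S = (\<Sum>k. b k * (m * J k - g x))"
  have "(\<lambda>k. b k * (m * J k - g x)) sums S"
    unfolding S_def using summable_rabs_cancel[OF summable] by (rule summable_sums)
  then have "(\<lambda>k. b k * (m * J k - g x) + g x * b k) sums (S + g x * 1)"
    by (intro sums_add sums_mult b_sums)
  then have "(\<lambda>k. inverse m * (b k * (m * J k - g x) + g x * b k)) sums (inverse m * (S + g x * 1))"
    by (rule sums_mult)
  moreover have "inverse m * (b k * (m * J k - g x) + g x * b k) = b k * J k" for k
    using m by (simp add: field_simps)
  ultimately have "BSS_operator n p g x = m * (inverse m * (S + g x))"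
    by (simp add: BSS_operator_def b_def J_def m_def sums_iff)
  then have "BSS_operator n p g x - g x = S"
    using m by (simp add: mult.assoc[symmetric])
  also have "\<bar>S\<bar> \<le> (\<Sum>k. \<bar>b k * (m * J k - g x)\<bar>)"
    unfolding S_def by (rule summable_rabs[OF summable])
  also have "\<dots> \<le> (\<Sum>k. b k * q k)"
    by (rule suminf_le[OF le summable sums_summable[OF q_sums]])
  also have "\<dots> = A + B * ((x\<^sup>2 + 2 * x) / m + 2 / m\<^sup>2)"
    by (rule sums_unique[OF q_sums, symmetric])
  also have "\<dots> \<le> A + B * (4 * (1 + x\<^sup>2) / m)"
  proof -
    have "2 / m\<^sup>2 \<le> 2 / m"
      using m by (simp add: field_simps power2_eq_square)
    moreover have "(x\<^sup>2 + 2 * x + 2) / m \<le> 4 * (1 + x\<^sup>2) / m"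
    proof (rule divide_right_mono)
      show "x\<^sup>2 + 2 * x + 2 \<le> 4 * (1 + x\<^sup>2)"
      proof -
        have "0 \<le> (x - 1)\<^sup>2 + (2 * x\<^sup>2 + 1)"
          by (intro add_nonneg_nonneg) auto
        then show ?thesis
          by (simp add: power2_diff)
      qed
    qed (use m in simp)
    ultimately have "(x\<^sup>2 + 2 * x) / m + 2 / m\<^sup>2 \<le> 4 * (1 + x\<^sup>2) / m"
      by (simp add: add_divide_distrib)
    then show ?thesis
      by (intro add_left_mono mult_left_mono B)
  qed
  finally show ?thesis
    by (simp add: m_def)
qed

section \<open>Pointwise bounds for functions of quadratic growth\<close>

text \<open>From \<open>t\<^sup>2 \<le> 2 * x\<^sup>2 + 2 * (t - x)\<^sup>2\<close>.\<close>

lemma quadratic_growth_difference: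
  fixes f :: "real \<Rightarrow> real" and M t x :: real
  assumes growth: "\<And>t. t \<ge> 0 \<Longrightarrow> \<bar>f t\<bar> \<le> M * (1 + t\<^sup>2)" and "M \<ge> 0" "t \<ge> 0" "x \<ge> 0"
  shows "\<bar>f t - f x\<bar> \<le> M * (2 + 3 * x\<^sup>2) + 2 * M * (t - x)\<^sup>2"
proof -
  have "t\<^sup>2 \<le> 2 * x\<^sup>2 + 2 * (t - x)\<^sup>2"
    using zero_le_power2[of "t - 2 * x"] by (simp add: power2_eq_square algebra_simps)
  then have "M * (2 + x\<^sup>2 + t\<^sup>2) \<le> M * (2 + x\<^sup>2 + (2 * x\<^sup>2 + 2 * (t - x)\<^sup>2))"
    using \<open>M \<ge> 0\<close> by (intro mult_left_mono) auto
  then show ?thesis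
    using growth[OF \<open>t \<ge> 0\<close>] growth[OF \<open>x \<ge> 0\<close>] by (simp add: algebra_simps)
qed

text \<open>Near \<open>x\<close> uniform continuity on a slightly larger compact interval makes the difference
  small; at distance at least \<open>d\<close> the quadratic growth is absorbed by \<open>(t - x)\<^sup>2 / d\<^sup>2 \<ge> 1\<close>.\<close>

lemma quadratic_modulus_on_compact:
  fixes f :: "real \<Rightarrow> real" and M R \<epsilon> :: real
  assumes cont: "continuous_on {0..} f"
    and growth: "\<And>t. t \<ge> 0 \<Longrightarrow> \<bar>f t\<bar> \<le> M * (1 + t\<^sup>2)" and M: "M \<ge> 0" and \<epsilon>: "\<epsilon> > 0"
  obtains K where "K \<ge> 0"
    and "\<And>x t. 0 \<le> x \<Longrightarrow> x \<le> R \<Longrightarrow> t \<ge> 0 \<Longrightarrow> \<bar>f t - f x\<bar> \<le> \<epsilon> + K * (t - x)\<^sup>2"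
proof -
  have "uniformly_continuous_on {0..R + 1} f"
    by (intro compact_uniformly_continuous continuous_on_subset[OF cont]) auto
  then obtain d0 where d0: "d0 > 0"
    and uc: "\<And>x t. x \<in> {0..R + 1} \<Longrightarrow> t \<in> {0..R + 1} \<Longrightarrow> dist t x < d0 \<Longrightarrow> dist (f t) (f x) < \<epsilon>"
    using \<epsilon> unfolding uniformly_continuous_on_def by metis
  \<comment> \<open>capped so that points within \<open>d\<close> of \<open>[0, R]\<close> stay below \<open>R + 1\<close>\<close>
  define d where "d = min d0 1"
  have d: "d > 0"
    using d0 by (simp add: d_def)
  define K where "K = M * (2 + 3 * R\<^sup>2) / d\<^sup>2 + 2 * M"
  show ?thesis
  proof (rule that[of K])
    show "K \<ge> 0"
      using M by (simp add: K_def)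
    fix x t :: real
    assume x: "0 \<le> x" "x \<le> R" and t: "t \<ge> 0"
    show "\<bar>f t - f x\<bar> \<le> \<epsilon> + K * (t - x)\<^sup>2"
    proof (cases "\<bar>t - x\<bar> < d")
      case True
      then have "\<bar>f t - f x\<bar> < \<epsilon>"
        using uc[of x t] x t by (auto simp: d_def dist_real_def)
      moreover have "0 \<le> K * (t - x)\<^sup>2"
        using \<open>K \<ge> 0\<close> by simp
      ultimately show ?thesis
        by linarith
    next
      case False
      then have "d\<^sup>2 \<le> (t - x)\<^sup>2"
        using d by (simp add: abs_le_square_iff[symmetric])
      then have far: "1 \<le> (t - x)\<^sup>2 / d\<^sup>2"
        using d by simp
      have "x\<^sup>2 \<le> R\<^sup>2"
        using x by (simp add: power_mono)
      then have "M * (2 + 3 * x\<^sup>2) \<le> M * (2 + 3 * R\<^sup>2) * 1"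
        using M by (simp add: mult_left_mono)
      also have "\<dots> \<le> M * (2 + 3 * R\<^sup>2) * ((t - x)\<^sup>2 / d\<^sup>2)"
        using M by (intro mult_left_mono far) simp
      also have "\<dots> = M * (2 + 3 * R\<^sup>2) / d\<^sup>2 * (t - x)\<^sup>2"
        by simp
      finally have "M * (2 + 3 * x\<^sup>2) + 2 * M * (t - x)\<^sup>2 \<le> K * (t - x)\<^sup>2"
        unfolding K_def by (simp only: distrib_right)
      then show ?thesis
        using quadratic_growth_difference[of f M t x, OF growth M t] x \<epsilon> by linarith
    qed
  qed
qed

section \<open>Weighted uniform convergence\<close>

lemma BSS_growth_bound:
  fixes f :: "real \<Rightarrow> real" and n p :: nat and M x :: real
  assumes np: "n + p > 0" and x: "x \<ge> 0" and cont: "continuous_on {0..} f"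
    and growth: "\<And>t. t \<ge> 0 \<Longrightarrow> \<bar>f t\<bar> \<le> M * (1 + t\<^sup>2)" and M: "M \<ge> 0"
  shows "\<bar>BSS_operator n p f x - f x\<bar> \<le> 11 * M * (1 + x\<^sup>2)"
proof -
  have "\<bar>BSS_operator n p f x - f x\<bar>
      \<le> M * (2 + 3 * x\<^sup>2) + 2 * M * (4 * (1 + x\<^sup>2) / real (n + p))"
    using M by (intro BSS_error_bound np x cont quadratic_growth_difference growth) auto
  also have "\<dots> \<le> M * (2 + 3 * x\<^sup>2) + 2 * M * (4 * (1 + x\<^sup>2))"
  proof -
    have "4 * (1 + x\<^sup>2) / real (n + p) \<le> 4 * (1 + x\<^sup>2) / 1"
      using np by (intro divide_left_mono) auto
    then show ?thesis
      using M by (intro add_left_mono mult_left_mono) auto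
  qed
  also have "\<dots> \<le> 11 * M * (1 + x\<^sup>2)"
    using M by (simp add: algebra_simps)
  finally show ?thesis .
qed

lemma BSS_weighted_error_eventually_small:
  fixes f :: "real \<Rightarrow> real" and p :: nat and \<alpha> \<epsilon> :: real
  assumes p: "p \<ge> 1" and f: "f \<in> C_x2" and \<alpha>: "\<alpha> > 0" and \<epsilon>: "\<epsilon> > 0"
  shows "\<forall>\<^sub>F n in sequentially. \<forall>x\<ge>0.
           \<bar>BSS_operator n p f x - f x\<bar> / (1 + x\<^sup>2) powr (1 + \<alpha>) \<le> \<epsilon>"
proof -
  obtain M where cont: "continuous_on {0..} f"
    and growth: "\<And>t. t \<ge> 0 \<Longrightarrow> \<bar>f t\<bar> \<le> M * (1 + t\<^sup>2)"
    using f by (auto simp: C_x2_def)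
  have M: "M \<ge> 0"
    using growth[of 0] by simp
  have "((\<lambda>x::real. 11 * M * (1 + x\<^sup>2) powr (- \<alpha>)) \<longlongrightarrow> 0) at_top"
    using \<alpha> by real_asymp
  then have "\<forall>\<^sub>F x in at_top. 11 * M * (1 + x\<^sup>2) powr (- \<alpha>) < \<epsilon>"
    using \<epsilon> by (rule order_tendstoD(2))
  then obtain R where R: "\<And>x. x \<ge> R \<Longrightarrow> 11 * M * (1 + x\<^sup>2) powr (- \<alpha>) < \<epsilon>"
    by (auto simp: eventually_at_top_linorder)
  obtain K where K: "K \<ge> 0"
    and modulus: "\<And>x t. 0 \<le> x \<Longrightarrow> x \<le> R \<Longrightarrow> t \<ge> 0 \<Longrightarrow> \<bar>f t - f x\<bar> \<le> \<epsilon> / 2 + K * (t - x)\<^sup>2"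
    using quadratic_modulus_on_compact[OF cont growth M, of "\<epsilon> / 2" R] \<epsilon> by auto
  have "((\<lambda>n. K * (4 * (1 + R\<^sup>2) / real (n + p))) \<longlongrightarrow> 0) sequentially"
    by real_asymp
  then have "\<forall>\<^sub>F n in sequentially. K * (4 * (1 + R\<^sup>2) / real (n + p)) < \<epsilon> / 2"
    using \<epsilon> by (intro order_tendstoD(2)) auto
  then show ?thesis
  proof eventually_elim
    case (elim n)
    show ?case
    proof (intro allI impI)
      fix x :: real
      assume x: "x \<ge> 0"
      have np: "n + p > 0"
        using p by simp
      have weight: "(1 + x\<^sup>2) powr (1 + \<alpha>) = (1 + x\<^sup>2) * (1 + x\<^sup>2) powr \<alpha>"
        by (subst powr_add) (simp add: add_nonneg_eq_0_iff)
      have pos: "1 + x\<^sup>2 > 0"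
        by (simp add: add_pos_nonneg)
      show "\<bar>BSS_operator n p f x - f x\<bar> / (1 + x\<^sup>2) powr (1 + \<alpha>) \<le> \<epsilon>"
      proof (cases "x \<ge> R")
        case True
        have "\<bar>BSS_operator n p f x - f x\<bar> / (1 + x\<^sup>2) powr (1 + \<alpha>)
            \<le> 11 * M * (1 + x\<^sup>2) / (1 + x\<^sup>2) powr (1 + \<alpha>)"
          by (intro divide_right_mono BSS_growth_bound np x cont growth M) auto
        also have "\<dots> = 11 * M * (1 + x\<^sup>2) powr (- \<alpha>)"
          using pos by (simp add: weight powr_minus divide_inverse)
        also have "\<dots> \<le> \<epsilon>"
          using R[OF True] by simp
        finally show ?thesis .
      next
        case False
        then have "x\<^sup>2 \<le> R\<^sup>2"
          using x by (simp add: power_mono)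
        then have "K * (4 * (1 + x\<^sup>2) / real (n + p)) \<le> K * (4 * (1 + R\<^sup>2) / real (n + p))"
          using K by (intro mult_left_mono divide_right_mono) auto
        moreover have "\<bar>BSS_operator n p f x - f x\<bar>
            \<le> \<epsilon> / 2 + K * (4 * (1 + x\<^sup>2) / real (n + p))"
          using False by (intro BSS_error_bound np x cont K modulus) auto
        ultimately have "\<bar>BSS_operator n p f x - f x\<bar> \<le> \<epsilon>"
          using elim by linarith
        moreover have "1 \<le> (1 + x\<^sup>2) powr (1 + \<alpha>)"
          using \<alpha> by (intro ge_one_powr_ge_zero) auto
        ultimately have "\<bar>BSS_operator n p f x - f x\<bar> / (1 + x\<^sup>2) powr (1 + \<alpha>) \<le> \<epsilon> / 1"
          using \<epsilon> by (intro frac_le) auto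
        then show ?thesis
          by simp
      qed
    qed
  qed
qed

theorem theorem4:
  fixes p :: nat and f :: "real \<Rightarrow> real" and \<alpha> :: real
  assumes "p \<ge> 1" and "f \<in> C_x2" and "\<alpha> > 0"
  shows "(\<lambda>n. SUP x\<in>{0..}.
            ereal (\<bar>BSS_operator n p f x - f x\<bar> / (1 + x\<^sup>2) powr (1 + \<alpha>)))
          \<longlonglongrightarrow> 0"
proof (rule order_tendstoI)
  fix a :: ereal
  assume "a < 0"
  also have "0 \<le> (SUP x\<in>{0..}.
      ereal (\<bar>BSS_operator n p f x - f x\<bar> / (1 + x\<^sup>2) powr (1 + \<alpha>)))" for n
    by (rule SUP_upper2[of 0]) auto
  finally show "\<forall>\<^sub>F n in sequentially. a < (SUP x\<in>{0..}.
      ereal (\<bar>BSS_operator n p f x - f x\<bar> / (1 + x\<^sup>2) powr (1 + \<alpha>)))"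
    by (simp add: always_eventually)
next
  fix a :: ereal
  assume "0 < a"
  then obtain \<epsilon> where \<epsilon>: "0 < ereal \<epsilon>" "ereal \<epsilon> < a"
    using ereal_dense2 by blast
  have "\<forall>\<^sub>F n in sequentially. \<forall>x\<ge>0.
      \<bar>BSS_operator n p f x - f x\<bar> / (1 + x\<^sup>2) powr (1 + \<alpha>) \<le> \<epsilon>"
    using assms \<epsilon> by (intro BSS_weighted_error_eventually_small) auto
  then show "\<forall>\<^sub>F n in sequentially. (SUP x\<in>{0..}.
      ereal (\<bar>BSS_operator n p f x - f x\<bar> / (1 + x\<^sup>2) powr (1 + \<alpha>))) < a"
  proof eventually_elim
    case (elim n)
    then have "(SUP x\<in>{0..}.
        ereal (\<bar>BSS_operator n p f x - f x\<bar> / (1 + x\<^sup>2) powr (1 + \<alpha>))) \<le> ereal \<epsilon>"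
      by (intro SUP_least) auto
    then show ?case
      using \<epsilon>(2) by (rule le_less_trans)
  qed
qed

end
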